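(* Let $\mathcal{D}$ be a Ryser design of order $v$ and index $\lambda$, with replication numbers $r_1>r_2$, and let $\rho=(r_1-1)/(r_2-1)$. For $i=1,2$ let $E_i$ be the set of points with replication number $r_i$ and $e_i=|E_i|$. Order the points so that the $e_1$ points of $E_1$ come first, and let $\mathsf{A}$ be the $v\times v$ point-block incidence matrix of $\mathcal{D}$ (rows indexed by points, columns by blocks), with block sizes (column sums) $k_1,\dots,k_v$. Let $\mathsf{D}=\mathrm{diag}(k_1-\lambda,\dots,k_v-\lambda)$ and $$\mathsf{R}=\begin{pmatrix}\rho\,\mathsf{J}_{e_1\times e_1} & \mathsf{J}_{e_1\times e_2}\\ \mathsf{J}_{e_2\times e_1} & \frac{1}{\rho}\mathsf{J}_{e_2\times e_2}\end{pmatrix},$$ where $\mathsf{J}$ denotes an all-ones matrix of the indicated size. Then $\mathsf{A}$ is invertible and $$\mathsf{A}^{-1}=\mathsf{D}^{-1}\mathsf{A}^T(\mathsf{I}_v+\mathsf{R})^{-1}=\mathsf{D}^{-1}\mathsf{A}^T\left(\mathsf{I}_v-\frac{\rho}{\lambda(\rho+1)^2}\mathsf{R}\right).$$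
   Context: A Ryser design of order $v$ and index $\lambda$ is a pair $(X,L)$ where $X$ is a set of $v$ points and $L$ is a collection of $v$ subsets (blocks) of $X$ such that any two distinct blocks meet in exactly $\lambda$ points, every block has size $>\lambda$, and there exist two blocks of different sizes. It is known (Ryser–Woodall) that there are integers $r_1\neq r_2$ with $r_1+r_2=v+1$ such that every point lies in exactly $r_1$ or exactly $r_2$ blocks; the labels are chosen so that $r_1>r_2$, and both sets $E_1,E_2$ are nonempty. *)

theory Defs
  imports "Jordan_Normal_Form.Gauss_Jordan_Elimination"
begin

text \<open>
  The blocks form a set: two equal blocks would meet in more than \<open>\<lambda>\<close> points, so a Ryser design
  cannot have repeated blocks.
\<close>

definition ryser_design :: "'a set \<Rightarrow> 'a set set \<Rightarrow> nat \<Rightarrow> nat \<Rightarrow> bool" where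
  "ryser_design X L v lam \<longleftrightarrow>
     finite X \<and> card X = v \<and> L \<subseteq> Pow X \<and> card L = v \<and>
     (\<forall>B\<in>L. \<forall>C\<in>L. B \<noteq> C \<longrightarrow> card (B \<inter> C) = lam) \<and>
     (\<forall>B\<in>L. lam < card B) \<and>
     (\<exists>B\<in>L. \<exists>C\<in>L. card B \<noteq> card C)"

definition replication :: "'a set set \<Rightarrow> 'a \<Rightarrow> nat" where
  "replication L x = card {B \<in> L. x \<in> B}"

definition points_of_replication :: "'a set \<Rightarrow> 'a set set \<Rightarrow> nat \<Rightarrow> 'a set" where
  "points_of_replication X L r = {x \<in> X. replication L x = r}"

definition incidence_mat :: "'a list \<Rightarrow> 'a set list \<Rightarrow> real mat" where
  "incidence_mat ps bs =
     mat (length ps) (length bs) (\<lambda>(i, j). if ps ! i \<in> bs ! j then 1 else 0)"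

definition all_ones_mat :: "nat \<Rightarrow> nat \<Rightarrow> real mat" where
  "all_ones_mat m n = mat m n (\<lambda>_. 1)"

text \<open>
  \<^const>\<open>mat_inverse\<close> returns \<open>None\<close> on singular matrices, so the value below is meaningful only
  when the argument is invertible.
\<close>

definition inv_mat :: "real mat \<Rightarrow> real mat" where
  "inv_mat M = the (mat_inverse M)"

end

theory Submission
  imports Defs "Jordan_Normal_Form.Determinant"
begin

text \<open>
  Write \<open>d\<^sub>j = k\<^sub>j - \<lambda>\<close>, so that \<open>A\<^sup>T A = D + \<lambda>J\<close>. This is a rank-one perturbation of a positive
  diagonal matrix, so \<open>A\<close> is invertible with an explicit inverse, and \<open>A A\<^sup>-\<^sup>1 = I\<close> reads
  \<open>A D\<^sup>-\<^sup>1 A\<^sup>T = I + c y y\<^sup>T\<close> with \<open>y = A D\<^sup>-\<^sup>1 1\<close> and a constant \<open>c > 0\<close>. As \<open>A\<close> has entries 0 and 1,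
  the diagonal gives \<open>y\<^sub>i = 1 + c y\<^sub>i\<^sup>2\<close>, so \<open>y\<close> takes at most two values, and applying the identity
  to the all-ones vector shows that \<open>r\<^sub>i - 1\<close> is proportional to \<open>y\<^sub>i\<close>. Hence \<open>\<rho>\<close> is the quotient
  of the two roots of \<open>c t\<^sup>2 - t + 1\<close>, which makes \<open>c y y\<^sup>T\<close> equal to \<open>R\<close>.
\<close>

lemma
  assumes M: "M \<in> carrier_mat n n" and N: "N \<in> carrier_mat n n" and MN: "M * N = 1\<^sub>m n"
  shows right_inverse_invertible_mat: "invertible_mat M"
    and right_inverse_inv_mat: "inv_mat M = N"
proof -
  have NM: "N * M = 1\<^sub>m n"
    using mat_mult_left_right_inverse[OF M N MN] .
  show "invertible_mat M"
    using M N MN NM by (auto simp: invertible_mat_def inverts_mat_def)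
  \<comment> \<open>\<open>mat_inverse\<close> yields \<open>None\<close> only outside the units of
    the matrix ring, and \<open>N\<close> shows that \<open>M\<close> is a unit.\<close>
  obtain K where K: "mat_inverse M = Some K"
    using mat_inverse(1)[OF M, of "()"] M N MN NM
    by (cases "mat_inverse M") (auto simp: Units_def ring_mat_def)
  have KM: "K * M = 1\<^sub>m n" and KC: "K \<in> carrier_mat n n"
    using mat_inverse(2)[OF M K] by auto
  have "K = K * (M * N)"
    using KC MN by simp
  also have "\<dots> = K * M * N"
    using KC M N by simp
  also have "\<dots> = N"
    using KM N by simp
  finally show "inv_mat M = N"
    by (simp add: inv_mat_def K)
qed

lemma sum_diagonal_plus_const:
  fixes d :: "nat \<Rightarrow> real"
  assumes "j < n" "\<And>m. m < n \<Longrightarrow> d m > 0"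
  shows "(\<Sum>m<n. ((if m = j then d m else 0) + lam) / d m) = 1 + lam * (\<Sum>m<n. 1 / d m)"
proof -
  have "(\<Sum>m<n. ((if m = j then d m else 0) + lam) / d m)
      = (\<Sum>m<n. (if m = j then 1 else 0) + lam * (1 / d m))"
    using assms(2) by (intro sum.cong refl) (force simp: add_divide_distrib)
  also have "\<dots> = 1 + lam * (\<Sum>m<n. 1 / d m)"
    using assms(1) by (simp add: sum.distrib sum_distrib_left)
  finally show ?thesis .
qed

section \<open>Square 0-1 matrices with Gram matrix \<open>D + lam J\<close>\<close>

locale ryser_matrix =
  fixes n :: nat and a :: "nat \<Rightarrow> nat \<Rightarrow> real" and d :: "nat \<Rightarrow> real" and lam :: real
  assumes lam_pos: "lam > 0"
    and d_pos: "\<And>j. j < n \<Longrightarrow> d j > 0"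
    and zero_one: "\<And>i j. a i j \<in> {0, 1}"
    and gram: "\<And>j l. j < n \<Longrightarrow> l < n \<Longrightarrow>
      (\<Sum>i<n. a i j * a i l) = (if j = l then d j else 0) + lam"
begin

definition S :: real where "S = (\<Sum>j<n. 1 / d j)"

text \<open>The Sherman-Morrison coefficient: \<open>(D + lam J)^-1 = D^-1 - c D^-1 J D^-1\<close>,
  where \<open>S\<close> is the sum of the entries of \<open>D^-1\<close>.\<close>

definition c :: real where "c = lam / (1 + lam * S)"

definition y :: "nat \<Rightarrow> real" where "y i = (\<Sum>j<n. a i j / d j)"

lemma S_nonneg: "S \<ge> 0"
  unfolding S_def by (intro sum_nonneg) (use d_pos in \<open>force simp: less_imp_le\<close>)

lemma denominator_pos: "1 + lam * S > 0"
  using S_nonneg lam_pos by (simp add: add_pos_nonneg)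

lemma c_pos: "c > 0"
  using denominator_pos lam_pos by (simp add: c_def)

lemma square_entry: "a i j * a i j = a i j"
  using zero_one[of i j] by auto

lemma column_sum: "j < n \<Longrightarrow> (\<Sum>i<n. a i j) = d j + lam"
  using gram[of j j] by (simp add: square_entry)

text \<open>In matrix form, \<open>y^T A = 1^T D^-1 (A^T A) = 1^T D^-1 (D + lam J)\<close>, with
  \<open>1\<close> the all-ones vector.\<close>

lemma column_weighted_sum:
  assumes l: "l < n"
  shows "(\<Sum>i<n. y i * a i l) = 1 + lam * S"
proof -
  have "(\<Sum>i<n. y i * a i l) = (\<Sum>i<n. \<Sum>m<n. a i m * a i l / d m)"
    by (simp add: y_def sum_distrib_right)
  also have "\<dots> = (\<Sum>m<n. \<Sum>i<n. a i m * a i l / d m)"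
    by (rule sum.swap)
  also have "\<dots> = (\<Sum>m<n. ((if m = l then d m else 0) + lam) / d m)"
    using l by (intro sum.cong refl) (simp add: gram flip: sum_divide_distrib)
  also have "\<dots> = 1 + lam * S"
    unfolding S_def using l d_pos by (rule sum_diagonal_plus_const)
  finally show ?thesis .
qed

lemma row_weighted_gram:
  assumes i: "i < n" and k: "k < n"
  shows "(\<Sum>j<n. a i j * a k j / d j) = (if i = k then 1 else 0) + c * y i * y k"
proof -
  define A where "A = mat n n (\<lambda>(i, j). a i j)"
  \<comment> \<open>This is \<open>(A^T A)^-1 A^T\<close> with the Gram matrix inverted by
    Sherman-Morrison, hence a left inverse of \<open>A\<close>.\<close>
  define B where "B = mat n n (\<lambda>(j, i). (a i j - c * y i) / d j)"
  have carr: "A \<in> carrier_mat n n" "B \<in> carrier_mat n n"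
    by (simp_all add: A_def B_def)
  have "B * A = 1\<^sub>m n"
  proof (rule eq_matI)
    fix j l assume "j < dim_row (1\<^sub>m n :: real mat)" "l < dim_col (1\<^sub>m n :: real mat)"
    then have j: "j < n" and l: "l < n" by auto
    have "(B * A) $$ (j, l) = (\<Sum>i<n. (a i j - c * y i) / d j * a i l)"
      using j l by (simp add: A_def B_def scalar_prod_def atLeast0LessThan)
    also have "\<dots> = (\<Sum>i<n. (a i j * a i l - c * (y i * a i l)) / d j)"
      by (simp add: algebra_simps)
    also have "\<dots> = ((\<Sum>i<n. a i j * a i l) - c * (\<Sum>i<n. y i * a i l)) / d j"
      by (simp add: sum_subtractf sum_distrib_left flip: sum_divide_distrib)
    \<comment> \<open>The constant \<open>lam\<close> from \<open>gram\<close> cancels against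
      \<open>c * (1 + lam * S) = lam\<close>.\<close>
    also have "\<dots> = 1\<^sub>m n $$ (j, l)"
      using j l d_pos[OF j] denominator_pos
      by (auto simp: gram column_weighted_sum c_def)
    finally show "(B * A) $$ (j, l) = 1\<^sub>m n $$ (j, l)" .
  qed (auto simp: A_def B_def)
  \<comment> \<open>Squareness of \<open>A\<close> turns the left inverse into a right inverse, and
    so the information on columns into information on rows.\<close>
  then have AB: "A * B = 1\<^sub>m n"
    using mat_mult_left_right_inverse[OF carr(2,1)] by blast
  have "(if i = k then 1 else 0) = (A * B) $$ (i, k)"
    using i k AB by simp
  also have "\<dots> = (\<Sum>j<n. a i j * ((a k j - c * y k) / d j))"
    using i k by (simp add: A_def B_def scalar_prod_def atLeast0LessThan)
  also have "\<dots> = (\<Sum>j<n. a i j * a k j / d j - c * y k * (a i j / d j))"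
    by (intro sum.cong refl) (simp add: right_diff_distrib diff_divide_distrib mult_ac)
  also have "\<dots> = (\<Sum>j<n. a i j * a k j / d j) - c * y k * y i"
    by (simp add: sum_subtractf y_def sum_distrib_left)
  finally show ?thesis by (simp add: mult_ac)
qed

lemma y_quadratic: "i < n \<Longrightarrow> y i = 1 + c * y i * y i"
  using row_weighted_gram[of i i] by (simp add: square_entry y_def)

lemma y_nonzero: "i < n \<Longrightarrow> y i \<noteq> 0"
  using y_quadratic[of i] by auto

lemma sum_y: "(\<Sum>i<n. y i) = real n + lam * S"
proof -
  have "(\<Sum>i<n. y i) = (\<Sum>j<n. \<Sum>i<n. a i j / d j)"
    unfolding y_def by (rule sum.swap)
  also have "\<dots> = (\<Sum>j<n. 1 + lam * (1 / d j))"
    by (intro sum.cong refl)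
      (use d_pos in \<open>force simp: column_sum add_divide_distrib simp flip: sum_divide_distrib\<close>)
  also have "\<dots> = real n + lam * S"
    by (simp add: sum.distrib S_def sum_distrib_left)
  finally show ?thesis .
qed

text \<open>The trace of the rank-one matrix \<open>c y y^T\<close>, hence the factor by which this
  matrix is multiplied when squared.\<close>

lemma sum_y_squares: "(\<Sum>i<n. c * y i * y i) = lam * S"
proof -
  have "(\<Sum>i<n. c * y i * y i) = (\<Sum>i<n. y i - 1)"
    using y_quadratic by (intro sum.cong refl) (auto simp: algebra_simps)
  then show ?thesis
    by (simp add: sum_subtractf sum_y)
qed

text \<open>Apply \<open>row_weighted_gram\<close> to the all-ones vector: summing
  \<open>a k j\<close> over \<open>k\<close> gives the column sum \<open>d j + lam\<close>, and
  division by \<open>d j\<close> leaves the row sum plus \<open>lam * y i\<close>.\<close>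

lemma row_sum:
  assumes i: "i < n"
  shows "(\<Sum>j<n. a i j) - 1 = (c * (\<Sum>k<n. y k) - lam) * y i"
proof -
  have "(\<Sum>j<n. a i j) + lam * y i = (\<Sum>j<n. a i j / d j * (d j + lam))"
    unfolding y_def sum_distrib_left sum.distrib[symmetric]
    using d_pos by (intro sum.cong refl) (force simp: field_simps)
  also have "\<dots> = (\<Sum>j<n. \<Sum>k<n. a i j * a k j / d j)"
    by (intro sum.cong refl) (simp add: sum_distrib_left flip: column_sum)
  also have "\<dots> = (\<Sum>k<n. \<Sum>j<n. a i j * a k j / d j)"
    by (rule sum.swap)
  also have "\<dots> = (\<Sum>k<n. (if i = k then 1 else 0) + c * y i * y k)"
    using i by (intro sum.cong refl) (simp add: row_weighted_gram)
  also have "\<dots> = 1 + c * y i * (\<Sum>k<n. y k)"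
    using i by (simp add: sum.distrib sum_distrib_left)
  finally show ?thesis by (simp add: algebra_simps)
qed

section \<open>Two distinct row sums and the roots of \<open>c t^2 - t + 1\<close>\<close>

context
  fixes p q :: nat and rho :: real
  assumes p: "p < n" and q: "q < n"
    and row_sums_neq: "(\<Sum>j<n. a p j) \<noteq> (\<Sum>j<n. a q j)"
    and rho: "rho = ((\<Sum>j<n. a p j) - 1) / ((\<Sum>j<n. a q j) - 1)"
begin

lemma slope_nonzero: "c * (\<Sum>k<n. y k) - lam \<noteq> 0"
  using row_sums_neq row_sum[OF p] row_sum[OF q] by auto

text \<open>By \<open>row_sum\<close>, numerator and denominator are multiples of \<open>y p\<close>
  and \<open>y q\<close> by the same nonzero slope, which cancels.\<close>

lemma rho_quotient: "rho = y p / y q"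
  using slope_nonzero by (simp add: rho row_sum p q)

lemma rho_nonzero: "rho \<noteq> 0"
  using y_nonzero p q by (simp add: rho_quotient)

text \<open>Vieta: subtracting the quadratic equations of \<open>y p\<close> and \<open>y q\<close>
  leaves a multiple of their nonzero difference.\<close>

lemma roots_sum: "c * (y p + y q) = 1"
proof -
  have neq: "y p \<noteq> y q"
    using row_sums_neq row_sum[OF p] row_sum[OF q] by auto
  have "(y p - y q) * (c * (y p + y q)) = y p - y q"
    using y_quadratic[OF p] y_quadratic[OF q] by (simp add: algebra_simps)
  then show ?thesis using neq by simp
qed

lemma roots_product: "c * y p * y q = 1"
proof -
  have "y p = y p * (c * (y p + y q))"
    by (simp add: roots_sum)
  then show ?thesis
    using y_quadratic[OF p] by (simp add: algebra_simps)
qed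

lemma square_p: "c * y p * y p = rho"
  using roots_product y_nonzero[OF q] by (simp add: rho_quotient field_simps)

lemma square_q: "c * y q * y q = 1 / rho"
  using roots_product y_nonzero[OF p] y_nonzero[OF q] by (simp add: rho_quotient field_simps)

text \<open>The slope in \<open>row_sum\<close> is nonzero, so the row sum determines
  \<open>y\<close>; this makes \<open>y\<close> constant on each class of points.\<close>

lemma y_eqI:
  assumes "i < n" "k < n" "(\<Sum>j<n. a i j) = (\<Sum>j<n. a k j)"
  shows "y i = y k"
  using assms row_sum[of i] row_sum[of k] slope_nonzero by simp

lemma rank_one_coefficient: "rho / (lam * (rho + 1)\<^sup>2) = 1 / (1 + lam * S)"
proof -
  have "(rho + 1)\<^sup>2 / rho = rho + 2 + 1 / rho"
    using rho_nonzero by (simp add: field_simps power2_eq_square)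
  \<comment> \<open>The terms are \<open>c * y p * y p\<close>, twice \<open>c * y p * y q\<close>,
    and \<open>c * y q * y q\<close>: a perfect square up to the factor \<open>c\<close>.\<close>
  also have "\<dots> = c * (y p + y q) * (y p + y q)"
    using roots_product square_p square_q by (simp add: algebra_simps)
  also have "\<dots> = 1 / c"
    using roots_sum c_pos by (simp add: field_simps)
  finally have *: "(rho + 1)\<^sup>2 / rho = 1 / c" .
  have "rho / (lam * (rho + 1)\<^sup>2) = 1 / (lam * ((rho + 1)\<^sup>2 / rho))"
    by simp
  then show ?thesis
    using lam_pos unfolding * by (simp add: c_def)
qed

end

end

section \<open>From Ryser designs to 0-1 matrices\<close>

lemma ryser_design_index_pos:
  assumes "ryser_design X L v lam"
  shows "lam > 0"
proof (rule ccontr)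
  assume "\<not> lam > 0"
  then have lam: "lam = 0" by simp
  from assms have fX: "finite X" and cX: "card X = v" and sub: "L \<subseteq> Pow X" and cL: "card L = v"
    and disj: "\<And>B C. B \<in> L \<Longrightarrow> C \<in> L \<Longrightarrow> B \<noteq> C \<Longrightarrow> card (B \<inter> C) = 0"
    and pos: "\<And>B. B \<in> L \<Longrightarrow> 0 < card B"
    and ex: "\<exists>B\<in>L. \<exists>C\<in>L. card B \<noteq> card C"
    unfolding ryser_design_def lam by auto
  have fL: "finite L" using sub fX by (meson finite_Pow_iff finite_subset)
  have fB: "finite B" if "B \<in> L" for B using that sub fX by (auto intro: finite_subset)
  have pw: "disjoint L"
    using disj fB unfolding disjoint_def by (metis card_0_eq finite_Int)
  obtain B where B: "B \<in> L" "card B \<noteq> 1" using ex by metis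
  \<comment> \<open>For \<open>lam = 0\<close> the blocks are disjoint, nonempty and not all
    singletons, so the \<open>v\<close> blocks would cover more than \<open>v\<close>
    points.\<close>
  have "(\<Sum>B\<in>L. 1) < (\<Sum>B\<in>L. card B)"
  proof (rule sum_strict_mono_ex1[OF fL])
    show "\<forall>B\<in>L. 1 \<le> card B" using pos by (simp add: Suc_le_eq)
    show "\<exists>B\<in>L. 1 < card B" using B pos[of B] by (intro bexI[of _ B]) auto
  qed
  also have "(\<Sum>B\<in>L. card B) = card (\<Union>L)"
    using card_Union_disjoint[OF pw fB] by simp
  also have "\<dots> \<le> card X"
    using sub fX by (intro card_mono) auto
  finally show False using cX cL by simp
qed

lemma card_eq_sum_nth:
  assumes "distinct xs"
  shows "real (card {x \<in> set xs. P x}) = (\<Sum>i<length xs. if P (xs ! i) then 1 else 0)"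
proof -
  have "real (card {x \<in> set xs. P x}) = (\<Sum>x\<in>set xs. if P x then 1 else 0)"
    by (simp add: sum.If_cases Int_def)
  also have "\<dots> = (\<Sum>i<length xs. if P (xs ! i) then 1 else 0)"
    by (rule sum.reindex_bij_betw[symmetric]) (rule bij_betw_nth[OF assms], auto)
  finally show ?thesis .
qed

lemma ryser_matrix_of_design:
  assumes des: "ryser_design X L v lam"
    and ps: "distinct ps" "set ps = X" and bs: "distinct bs" "set bs = L"
  shows "ryser_matrix v (\<lambda>i j. if ps ! i \<in> bs ! j then 1 else 0)
    (\<lambda>j. real (card (bs ! j)) - real lam) (real lam)"
proof
  from des have cX: "card X = v" and sub: "L \<subseteq> Pow X" and cL: "card L = v"
    and meet: "\<And>B C. B \<in> L \<Longrightarrow> C \<in> L \<Longrightarrow> B \<noteq> C \<Longrightarrow> card (B \<inter> C) = lam"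
    and size: "\<And>B. B \<in> L \<Longrightarrow> lam < card B"
    unfolding ryser_design_def by auto
  have lens: "length ps = v" "length bs = v"
    using distinct_card[OF ps(1)] distinct_card[OF bs(1)] ps bs cX cL by auto
  have mem: "bs ! j \<in> L" if "j < v" for j
    using that bs(2) lens(2) nth_mem[of j bs] by simp
  show "0 < real lam" using ryser_design_index_pos[OF des] by simp
  show "0 < real (card (bs ! j)) - real lam" if "j < v" for j
    using size[OF mem[OF that]] by simp
  fix j l assume j: "j < v" and l: "l < v"
  have "(\<Sum>i<v. (if ps ! i \<in> bs ! j then 1 else 0) * (if ps ! i \<in> bs ! l then 1 else 0))
      = (\<Sum>i<length ps. if ps ! i \<in> bs ! j \<inter> bs ! l then 1 else 0 :: real)"
    unfolding lens(1) by (rule sum.cong) simp_all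
  also have "\<dots> = real (card {x \<in> X. x \<in> bs ! j \<inter> bs ! l})"
    unfolding ps(2)[symmetric] by (rule card_eq_sum_nth[OF ps(1), symmetric])
  also have "{x \<in> X. x \<in> bs ! j \<inter> bs ! l} = bs ! j \<inter> bs ! l"
    using mem[OF j] sub by auto
  \<comment> \<open>Distinctness of \<open>bs\<close> makes \<open>j = l\<close> equivalent to
    equality of the two blocks.\<close>
  also have "real (card (bs ! j \<inter> bs ! l))
      = (if j = l then real (card (bs ! j)) - real lam else 0) + real lam"
    using meet[OF mem[OF j] mem[OF l]] j l bs(1) lens by (auto simp: nth_eq_iff_index_eq)
  finally show "(\<Sum>i<v. (if ps ! i \<in> bs ! j then 1 else 0) * (if ps ! i \<in> bs ! l then 1 else 0))
      = (if j = l then real (card (bs ! j)) - real lam else 0) + real lam" .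
qed auto

section \<open>Matrix identities for the ordered incidence matrix\<close>

theorem theorem1p10:
  fixes X :: "'a set" and L :: "'a set set" and v lam r1 r2 e1 e2 :: nat
    and rho :: real and E1 E2 :: "'a set"
    and ps :: "'a list" and bs :: "'a set list"
    and A D R :: "real mat"
  assumes "ryser_design X L v lam"
    and "replication L ` X = {r1, r2}" and "r1 > r2"
    and "rho = (real r1 - 1) / (real r2 - 1)"
    and "E1 = points_of_replication X L r1" and "e1 = card E1"
    and "E2 = points_of_replication X L r2" and "e2 = card E2"
    and "distinct ps" and "set ps = X" and "set (take e1 ps) = E1"
    and "distinct bs" and "set bs = L"
    and "A = incidence_mat ps bs"
    and "D = mat_diag v (\<lambda>j. real (card (bs ! j)) - real lam)"
    and "R = four_block_mat
               (rho \<cdot>\<^sub>m all_ones_mat e1 e1) (all_ones_mat e1 e2)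
               (all_ones_mat e2 e1) ((1 / rho) \<cdot>\<^sub>m all_ones_mat e2 e2)"
  shows "invertible_mat A \<and> invertible_mat D \<and> invertible_mat (1\<^sub>m v + R) \<and>
    inv_mat A = inv_mat D * A\<^sup>T * inv_mat (1\<^sub>m v + R) \<and>
    inv_mat D * A\<^sup>T * inv_mat (1\<^sub>m v + R) =
      inv_mat D * A\<^sup>T * (1\<^sub>m v - (rho / (real lam * (rho + 1)\<^sup>2)) \<cdot>\<^sub>m R)"
proof -
  define a :: "nat \<Rightarrow> nat \<Rightarrow> real" where "a = (\<lambda>i j. if ps ! i \<in> bs ! j then 1 else 0)"
  define d where "d = (\<lambda>j. real (card (bs ! j)) - real lam)"
  interpret ryser_matrix v a d "real lam"
    unfolding a_def d_def by (rule ryser_matrix_of_design) (use assms in auto)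
  have cX: "card X = v" and cL: "card L = v" and fX: "finite X"
    using assms(1) by (auto simp: ryser_design_def)
  have lens: "length ps = v" "length bs = v"
    using distinct_card[OF assms(9)] distinct_card[OF assms(12)] assms(10,13) cX cL by auto
  have row: "(\<Sum>j<v. a i j) = real (replication L (ps ! i))" for i
    using card_eq_sum_nth[OF assms(12), of "\<lambda>B. ps ! i \<in> B"] assms(13)
    by (simp add: a_def replication_def lens)
  have memX: "ps ! i \<in> X" if "i < v" for i
    using that assms(10) lens nth_mem by blast
  have X_split: "X = E1 \<union> E2" "E1 \<inter> E2 = {}"
    using assms(2,3,5,7) by (auto simp: points_of_replication_def)
  then have e12: "e1 + e2 = v"
    using card_Un_disjoint[of E1 E2] fX cX assms(6,8) by auto
  have E1_iff: "ps ! i \<in> E1 \<longleftrightarrow> i < e1" if "i < v" for i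
    unfolding assms(11)[symmetric] using that lens assms(9) e12
    by (auto simp: in_set_conv_nth nth_eq_iff_index_eq)
  have r1: "(\<Sum>j<v. a i j) = real r1" if "i < e1" for i
    using E1_iff[of i] that e12 row assms(5) by (auto simp: points_of_replication_def)
  have r2: "(\<Sum>j<v. a i j) = real r2" if "i < v" "\<not> i < e1" for i
  proof -
    have "ps ! i \<in> E2"
      using E1_iff[of i] memX[of i] that X_split(1) by blast
    then show ?thesis
      by (simp add: row assms(7) points_of_replication_def)
  qed
  have ne: "E1 \<noteq> {}" "E2 \<noteq> {}"
  proof -
    have "r1 \<in> replication L ` X" "r2 \<in> replication L ` X" using assms(2) by auto
    then show "E1 \<noteq> {}" "E2 \<noteq> {}"
      unfolding assms(5,7) points_of_replication_def by auto
  qed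
  have "finite E1" "finite E2" using fX X_split by auto
  then have "e1 > 0" "e2 > 0" using ne assms(6,8) by (auto simp: card_gt_0_iff)
  \<comment> \<open>Counting from 0, index \<open>0\<close> is the first point of \<open>E1\<close>
    and index \<open>e1\<close> the first point of \<open>E2\<close>; they serve as representatives
    of the two classes.\<close>
  then have p: "0 < v" and q: "e1 < v" and p1: "0 < e1" and q1: "\<not> e1 < e1"
    using e12 by auto
  have neq: "(\<Sum>j<v. a 0 j) \<noteq> (\<Sum>j<v. a e1 j)"
    using r1[OF p1] r2[OF q q1] assms(3) by simp
  have rho: "rho = ((\<Sum>j<v. a 0 j) - 1) / ((\<Sum>j<v. a e1 j) - 1)"
    using r1[OF p1] r2[OF q q1] assms(4) by simp
  note facts = p q neq rho

  have y1: "y i = y 0" if "i < e1" for i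
    using that e12 r1 p1 by (intro y_eqI[OF facts]) auto
  have y2: "y i = y e1" if "i < v" "\<not> i < e1" for i
    using that e12 r2 q by (intro y_eqI[OF facts]) auto
  \<comment> \<open>The four blocks arise from \<open>c * y i * y k\<close> by replacing each index
    with its representative; the values are \<open>rho\<close>, \<open>1\<close>, \<open>1\<close>
    and \<open>1 / rho\<close>.\<close>
  have R: "R = mat v v (\<lambda>(i, k). c * y i * y k)"
  proof (rule eq_matI)
    fix i k assume "i < dim_row (mat v v (\<lambda>(i, k). c * y i * y k))"
      "k < dim_col (mat v v (\<lambda>(i, k). c * y i * y k))"
    then have i: "i < v" and k: "k < v" by auto
    show "R $$ (i, k) = mat v v (\<lambda>(i, k). c * y i * y k) $$ (i, k)"
      using i k e12 y1[of i] y1[of k] y2[OF i] y2[OF k] square_p[OF facts] square_q[OF facts]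
        roots_product[OF facts]
      by (cases "i < e1"; cases "k < e1")
        (auto simp: assms(16) all_ones_mat_def mult_ac)
  qed (use e12 in \<open>auto simp: assms(16) all_ones_mat_def\<close>)

  define F where "F = mat_diag v (\<lambda>j. 1 / d j)"
  have carr: "A \<in> carrier_mat v v" "D \<in> carrier_mat v v" "F \<in> carrier_mat v v"
      "R \<in> carrier_mat v v"
    using lens by (auto simp: assms(14,15) R F_def incidence_mat_def)
  have DF: "D * F = 1\<^sub>m v"
    using d_pos unfolding assms(15) F_def d_def[symmetric] mat_diag_diag
    by (intro eq_matI) (force simp: mat_diag_def)+
  note D_inv = right_inverse_invertible_mat[OF carr(2,3) DF]
    right_inverse_inv_mat[OF carr(2,3) DF]

  define alpha where "alpha = rho / (real lam * (rho + 1)\<^sup>2)"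
  \<comment> \<open>Since \<open>R^2 = lam S R\<close>, the product \<open>(I + R) N\<close> is
    \<open>I + (1 - alpha (1 + lam S)) R\<close>, and \<open>alpha\<close> makes the coefficient of
    \<open>R\<close> vanish.\<close>
  define N where "N = 1\<^sub>m v - alpha \<cdot>\<^sub>m R"
  have MC: "1\<^sub>m v + R \<in> carrier_mat v v" and NC: "N \<in> carrier_mat v v"
    using carr by (auto simp: N_def)
  have alpha: "alpha * (1 + real lam * S) = 1"
    using denominator_pos by (simp add: alpha_def rank_one_coefficient[OF facts])
  have RR: "R * R = (real lam * S) \<cdot>\<^sub>m R"
  proof (rule eq_matI)
    fix i k assume "i < dim_row ((real lam * S) \<cdot>\<^sub>m R)" "k < dim_col ((real lam * S) \<cdot>\<^sub>m R)"
    then have i: "i < v" and k: "k < v" by (auto simp: R)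
    have "(R * R) $$ (i, k) = (\<Sum>j<v. (c * y i * y j) * (c * y j * y k))"
      using i k by (simp add: R scalar_prod_def atLeast0LessThan)
    also have "\<dots> = (\<Sum>j<v. c * y j * y j) * (c * y i * y k)"
      unfolding sum_distrib_right by (simp add: mult_ac)
    also have "\<dots> = ((real lam * S) \<cdot>\<^sub>m R) $$ (i, k)"
      using i k by (simp add: sum_y_squares R)
    finally show "(R * R) $$ (i, k) = ((real lam * S) \<cdot>\<^sub>m R) $$ (i, k)" .
  qed (auto simp: R)
  have MN: "(1\<^sub>m v + R) * N = 1\<^sub>m v"
  proof -
    have "(1\<^sub>m v + R) * N = N + R * N"
      using carr NC by (simp add: add_mult_distrib_mat[of _ v v])
    also have "R * N = R - alpha \<cdot>\<^sub>m (R * R)"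
      using carr(4) by (simp add: N_def mult_smult_distrib[OF carr(4,4)]
          mult_minus_distrib_mat[OF carr(4) one_carrier_mat smult_carrier_mat[OF carr(4)]])
    also have "N + (R - alpha \<cdot>\<^sub>m (R * R)) = 1\<^sub>m v"
    proof (rule eq_matI)
      fix i k assume "i < dim_row (1\<^sub>m v :: real mat)" "k < dim_col (1\<^sub>m v :: real mat)"
      then have i: "i < v" and k: "k < v" by auto
      have "R $$ (i, k) = alpha * (1 + real lam * S) * R $$ (i, k)"
        by (simp add: alpha)
      then show "(N + (R - alpha \<cdot>\<^sub>m (R * R))) $$ (i, k) = 1\<^sub>m v $$ (i, k)"
        unfolding RR using i k carr by (simp add: N_def algebra_simps)
    qed (use carr in \<open>auto simp: N_def\<close>)
    finally show ?thesis .
  qed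
  note M_inv = right_inverse_invertible_mat[OF MC NC MN] right_inverse_inv_mat[OF MC NC MN]

  \<comment> \<open>The matrix form of \<open>row_weighted_gram\<close>, with \<open>F\<close> the
    inverse of \<open>D\<close>.\<close>
  have AFA: "A * (F * A\<^sup>T) = 1\<^sub>m v + R"
  proof (rule eq_matI)
    fix i k assume "i < dim_row (1\<^sub>m v + R)" "k < dim_col (1\<^sub>m v + R)"
    then have i: "i < v" and k: "k < v" by (auto simp: R)
    have FA: "F * A\<^sup>T = mat v v (\<lambda>(j, k). a k j / d j)"
      unfolding F_def using carr(1) lens
      by (subst mat_diag_mult_left[of _ v v])
        (auto simp: assms(14) incidence_mat_def a_def intro!: eq_matI)
    have "(A * (F * A\<^sup>T)) $$ (i, k) = (\<Sum>j<v. a i j * a k j / d j)"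
      unfolding FA using i k lens
      by (simp add: assms(14) incidence_mat_def scalar_prod_def atLeast0LessThan
          flip: a_def)
    also have "\<dots> = (1\<^sub>m v + R) $$ (i, k)"
      using i k by (simp add: row_weighted_gram R)
    finally show "(A * (F * A\<^sup>T)) $$ (i, k) = (1\<^sub>m v + R) $$ (i, k)" .
  qed (use carr in auto)
  have BC: "F * A\<^sup>T * N \<in> carrier_mat v v"
    using carr NC by auto
  have "A * (F * A\<^sup>T * N) = A * (F * A\<^sup>T) * N"
    using carr NC by (intro assoc_mult_mat[symmetric]) auto
  then have AB: "A * (F * A\<^sup>T * N) = 1\<^sub>m v"
    by (simp add: AFA MN)
  \<comment> \<open>As \<open>inv_mat D = F\<close> and
    \<open>inv_mat (1\<^sub>m v + R) = N\<close>, both products in the claim are the right inverse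
    of \<open>A\<close> just found.\<close>
  show ?thesis
    using right_inverse_invertible_mat[OF carr(1) BC AB] right_inverse_inv_mat[OF carr(1) BC AB]
      D_inv M_inv by (simp add: N_def alpha_def)
qed

end
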